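(* Let $n\ge 2$ and $q\ge 1$ be integers. Then \begin{align*} f_q(n)&=2f_q(n-1,n)-f_q(n-1)+r_q(n),\\ f_q(n-1,n)&=2f_q(n-1)-f_q(n-2,n-1)+s_q(n), \end{align*} where $f_q(m)=f_q(m,m)$, \[ r_q(n)=8\bigl(e_q(2)+e_q(3)+\dots+e_q(n)\bigr), \] and so $r_q(n)-r_q(n-1)=8e_q(n)$, and \[ s_q(n)=2(n-1)e_q(n). \] The initial values are $f_q(n)=f_q(n-1,n)=0$ for all integers $n$ with $1\le n\le q$.
   Context: For integers $n_1,n_2\ge 0$ and $q\ge 1$, \[ f_q(n_1,n_2)=\sum_{\substack{-n_1<i_1<n_1,\ -n_2<i_2<n_2\\ \gcd(i_1,i_2)=q}}(n_1-|i_1|)(n_2-|i_2|), \] the sum being over integer pairs $(i_1,i_2)$, with $\gcd\ge 0$ and $\gcd(0,0)=0$; an empty sum is $0$ (so in particular $f_q(0,n_2)=0$). For integers $n\ge 2$ and $q\ge 1$, \[ e_q(n)=\begin{cases}\phi\bigl(\frac{n-1}{q}\bigr)&\text{if } q\mid n-1,\\ 0&\text{if } q\nmid n-1,\end{cases} \] where $\phi$ is the Euler totient function. By the empty-sum convention, $r_q(1)=0$. *)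

theory Defs
  imports "HOL-Number_Theory.Totient"
begin

definition f :: "nat \<Rightarrow> nat \<Rightarrow> nat \<Rightarrow> int" where
  "f q n1 n2 =
     (\<Sum>(i1, i2) \<in> {(i1, i2) \<in> {- int n1 <..< int n1} \<times> {- int n2 <..< int n2}.
                     gcd i1 i2 = int q}.
        (int n1 - \<bar>i1\<bar>) * (int n2 - \<bar>i2\<bar>))"

abbreviation f_diag :: "nat \<Rightarrow> nat \<Rightarrow> int" where
  "f_diag q m \<equiv> f q m m"

(* Meaningful for n \<ge> 2 and q \<ge> 1 only. *)
definition e :: "nat \<Rightarrow> nat \<Rightarrow> nat" where
  "e q n = (if q dvd n - 1 then totient ((n - 1) div q) else 0)"

definition r :: "nat \<Rightarrow> nat \<Rightarrow> int" where
  "r q n = 8 * (\<Sum>k = 2..n. int (e q k))"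

definition s :: "nat \<Rightarrow> nat \<Rightarrow> int" where
  "s q n = 2 * (int n - 1) * int (e q n)"

end

theory Submission
  imports Defs
begin

text \<open>
  Extend the weight \<open>n - \<bar>i\<bar>\<close> by zero to all integers (\<open>hat\<close>). Up to the symmetry of \<open>f\<close>, both
  recurrences are second differences of \<open>f\<close>. The mixed one,
  \<open>f(n,n) - f(n-1,n) - f(n,n-1) + f(n-1,n-1)\<close>, replaces every weight by 1 and hence counts the
  pairs of gcd \<open>q\<close> in a square, which is done boundary by boundary. The one in the second
  argument at \<open>m = n - 1\<close> is supported on \<open>\<bar>i\<^sub>2\<bar> = m\<close>, where translating the negative \<open>i\<^sub>1\<close> by
  \<open>m\<close> makes the weights of each residue class modulo \<open>m\<close> add up to \<open>m\<close>.
\<close>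

definition hat :: "nat \<Rightarrow> int \<Rightarrow> int" where
  "hat n i = max 0 (int n - \<bar>i\<bar>)"

text \<open>The bound \<open>N\<close> is free, so values of \<open>f\<close> at different arguments
  become sums over one common square and can be combined termwise; all added terms have weight
  0.\<close>

lemma f_eq_sum_hat:
  assumes "n1 \<le> N" "n2 \<le> N"
  shows "f q n1 n2 = (\<Sum>i = - int N..int N. \<Sum>j = - int N..int N.
           of_bool (gcd i j = int q) * hat n1 i * hat n2 j)"
proof -
  let ?g = "\<lambda>(i, j). of_bool (gcd i j = int q) * hat n1 i * hat n2 j"
  have "f q n1 n2 = (\<Sum>x \<in> {(i, j) \<in> {- int n1 <..< int n1} \<times> {- int n2 <..< int n2}.
                     gcd i j = int q}. ?g x)"
    unfolding f_def by (rule sum.cong) (auto simp: hat_def max_def)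
  also have "\<dots> = (\<Sum>x \<in> {- int N..int N} \<times> {- int N..int N}. ?g x)"
    using assms by (intro sum.mono_neutral_left) (auto simp: hat_def max_def split: if_splits)
  also have "\<dots> = (\<Sum>i = - int N..int N. \<Sum>j = - int N..int N.
           of_bool (gcd i j = int q) * hat n1 i * hat n2 j)"
    by (simp add: sum.cartesian_product)
  finally show ?thesis .
qed

lemma f_commute: "f q n1 n2 = f q n2 n1"
proof -
  define N where "N = max n1 n2"
  have N: "n1 \<le> N" "n2 \<le> N"
    by (auto simp: N_def)
  show ?thesis
    unfolding f_eq_sum_hat[OF N] f_eq_sum_hat[OF N(2,1)]
    by (subst sum.swap) (simp add: gcd.commute mult_ac)
qed

lemma sum_gcd_eq:
  assumes "m \<ge> 1" "q \<ge> 1"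
  shows "(\<Sum>i = 0..<int m. of_bool (gcd i (int m) = int q)) = int (e q (m + 1))"
proof -
  have "(\<Sum>i = 0..<int m. of_bool (gcd i (int m) = int q))
      = (\<Sum>i \<in> {0..<m}. of_bool (gcd i m = q) :: int)"
    by (subst sum.reindex[of int "{0..<m}", simplified image_int_atLeastLessThan, simplified]) simp_all
  \<comment> \<open>Both 0 and \<open>m\<close> have gcd \<open>m\<close> with \<open>m\<close>, so
    0 may be traded for \<open>m\<close> to reach the range of
    \<open>card_gcd_eq_totient\<close>.\<close>
  also have "\<dots> = (\<Sum>i \<in> {0<..m}. of_bool (gcd i m = q))"
    using assms(1)
    by (intro sum.reindex_bij_witness[of _ "\<lambda>i. if i = m then 0 else i" "\<lambda>i. if i = 0 then m else i"]) auto
  also have "\<dots> = int (card {i \<in> {0<..m}. gcd i m = q})"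
    by (simp add: Int_def of_bool_def sum.If_cases)
  also have "card {i \<in> {0<..m}. gcd i m = q} = e q (m + 1)"
  proof (cases "q dvd m")
    case True
    then show ?thesis
      using card_gcd_eq_totient[of m q] assms by (simp add: e_def)
  next
    case False
    then have "{i \<in> {0<..m}. gcd i m = q} = {}"
      by auto
    with False show ?thesis
      by (simp add: e_def)
  qed
  finally show ?thesis .
qed

text \<open>Translation by \<open>m\<close> does not change the gcd with \<open>m\<close>. The
  factor \<open>h\<close> is arbitrary because both a tent weight and the constant 1 are
  needed.\<close>

lemma sum_shift_gcd:
  fixes m :: nat and h :: "int \<Rightarrow> int"
  shows "(\<Sum>i = - int m..<0. of_bool (gcd i (int m) = int q) * h i)
       = (\<Sum>i = 0..<int m. of_bool (gcd i (int m) = int q) * h (i - int m))"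
proof (rule sum.reindex_bij_witness[of _ "\<lambda>i. i - int m" "\<lambda>i. i + int m"])
  fix i
  show "of_bool (gcd (i + int m) (int m) = int q) * h (i + int m - int m)
      = of_bool (gcd i (int m) = int q) * h i"
    by simp
qed auto

lemma sum_symmetric_interval_Suc:
  "(\<Sum>i = - int (Suc k)..int (Suc k). h i)
     = (\<Sum>i = - int k..int k. h i) + h (int (Suc k)) + (h (- int (Suc k)) :: int)"
proof -
  have "{- int (Suc k)..int (Suc k)} = insert (int (Suc k)) (insert (- int (Suc k)) {- int k..int k})"
    by auto
  then show ?thesis
    by simp
qed

lemma sum_hat_gcd:
  assumes "m \<ge> 1" "q \<ge> 1" "m \<le> N"
  shows "(\<Sum>i = - int N..int N. of_bool (gcd i (int m) = int q) * hat m i)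
       = int m * int (e q (m + 1))"
proof -
  let ?A = "\<lambda>i. of_bool (gcd i (int m) = int q) :: int"
  \<comment> \<open>The endpoint \<open>- int m\<close> has weight 0; it is kept so that the
    negative half is a full residue system modulo \<open>m\<close>.\<close>
  have "(\<Sum>i = - int N..int N. ?A i * hat m i) = (\<Sum>i \<in> {- int m..<0} \<union> {0..<int m}. ?A i * hat m i)"
    using assms by (intro sum.mono_neutral_right) (auto simp: hat_def max_def)
  also have "\<dots> = (\<Sum>i = - int m..<0. ?A i * hat m i) + (\<Sum>i = 0..<int m. ?A i * hat m i)"
    by (intro sum.union_disjoint) auto
  also have "\<dots> = (\<Sum>i = 0..<int m. ?A i * (hat m (i - int m) + hat m i))"
    by (simp only: sum_shift_gcd sum.distrib distrib_left)
  \<comment> \<open>For 0 \<le> i < m the two weights are i and m - i.\<close>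
  also have "\<dots> = (\<Sum>i = 0..<int m. int m * ?A i)"
    by (rule sum.cong) (auto simp: hat_def max_def)
  also have "\<dots> = int m * int (e q (m + 1))"
    using sum_gcd_eq[OF assms(1,2)] by (simp only: flip: sum_distrib_left)
  finally show ?thesis .
qed

text \<open>Enlarging the square adds a boundary made of four half-open sides with one corner each.
  A side runs twice through the residues modulo its half-length, whence 4 * 2 = 8.\<close>

lemma sum_square_gcd:
  assumes "q \<ge> 1"
  shows "(\<Sum>i = - int m..int m. \<Sum>j = - int m..int m. of_bool (gcd i j = int q)) = r q (m + 1)"
proof (induction m)
  case 0
  \<comment> \<open>The only pair is (0, 0), whose gcd 0 differs from \<open>q\<close>, and
    \<open>r q 1\<close> is an empty sum.\<close>
  then show ?case
    using assms by (simp add: r_def)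
next
  case (Suc k)
  define m where "m = Suc k"
  define A where "A i = (of_bool (gcd i (int m) = int q) :: int)" for i
  have A_sym: "of_bool (gcd (int m) i = int q) = A i" "of_bool (gcd (- int m) i = int q) = A i"
    "of_bool (gcd i (int m) = int q) = A i" "of_bool (gcd i (- int m) = int q) = A i"
    "A (- int m) = A (int m)" for i
    by (simp_all add: A_def gcd.commute)
  have "(\<Sum>i = - int m..<int m. A i) = (\<Sum>i \<in> {- int m..<0} \<union> {0..<int m}. A i)"
    by (rule sum.cong) auto
  also have "\<dots> = (\<Sum>i = - int m..<0. A i) + (\<Sum>i = 0..<int m. A i)"
    by (intro sum.union_disjoint) auto
  also have "\<dots> = 2 * int (e q (m + 1))"
    using sum_shift_gcd[of m q "\<lambda>_. 1"] sum_gcd_eq[of m q] assms by (simp add: A_def m_def)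
  finally have half_open: "(\<Sum>i = - int m..<int m. A i) = 2 * int (e q (m + 1))" .
  have "{- int m..<int m} = insert (- int m) {- int k..int k}"
    by (auto simp: m_def)
  with half_open have side: "A (int m) + (\<Sum>i = - int k..int k. A i) = 2 * int (e q (m + 1))"
    using A_sym(5) by (simp add: m_def)
  have "(\<Sum>i = - int m..int m. \<Sum>j = - int m..int m. of_bool (gcd i j = int q) :: int)
      = (\<Sum>i = - int k..int k. \<Sum>j = - int k..int k. of_bool (gcd i j = int q))
        + 4 * (A (int m) + (\<Sum>i = - int k..int k. A i))"
    unfolding m_def sum_symmetric_interval_Suc sum.distrib
    unfolding m_def[symmetric] A_sym by simp
  also have "\<dots> = r q (k + 1) + 8 * int (e q (m + 1))"
    using Suc.IH side by simp
  also have "\<dots> = r q (m + 1)"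
    by (simp add: r_def m_def)
  finally show ?case
    unfolding m_def .
qed

lemma f_diag_Suc:
  assumes "q \<ge> 1"
  shows "f_diag q (Suc m) = 2 * f q m (Suc m) - f_diag q m + r q (Suc m)"
proof -
  let ?I = "{- int (Suc m)..int (Suc m)}"
  let ?B = "\<lambda>i j. of_bool (gcd i j = int q) :: int"
  define d where "d i = hat (Suc m) i - hat m i" for i
  \<comment> \<open>At \<bar>i\<bar> = m the smaller weight is already 0 and the larger one is 1, so
    the square of side indices up to \<open>m\<close> is closed.\<close>
  have d: "d i = of_bool (\<bar>i\<bar> \<le> int m)" for i
    by (auto simp: d_def hat_def max_def)
  have sum_d: "(\<Sum>i \<in> ?I. h i * d i) = (\<Sum>i = - int m..int m. h i)" for h :: "int \<Rightarrow> int"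
    unfolding d by (intro sum.mono_neutral_cong_right) auto
  have "f q (Suc m) (Suc m) - f q m (Suc m) - f q (Suc m) m + f q m m
      = (\<Sum>i \<in> ?I. \<Sum>j \<in> ?I. ?B i j * d i * d j)"
    unfolding f_eq_sum_hat[of "Suc m" "Suc m" "Suc m", OF order_refl order_refl]
      f_eq_sum_hat[of m "Suc m" m, OF le_SucI le_SucI, OF order_refl order_refl]
      f_eq_sum_hat[of m "Suc m" "Suc m", OF le_SucI order_refl, OF order_refl]
      f_eq_sum_hat[of "Suc m" "Suc m" m, OF order_refl le_SucI, OF order_refl]
    by (simp only: flip: sum_subtractf sum.distrib) (simp only: d_def algebra_simps)
  also have "\<dots> = (\<Sum>i = - int m..int m. \<Sum>j = - int m..int m. ?B i j)"
    by (simp only: sum_d flip: sum_distrib_right)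
  also have "\<dots> = r q (Suc m)"
    using sum_square_gcd[OF assms] by simp
  finally show ?thesis
    using f_commute[of q m "Suc m"] by simp
qed

lemma f_Suc_right:
  assumes "m \<ge> 1" "q \<ge> 1"
  shows "f q m (Suc m) = 2 * f_diag q m - f q (m - 1) m + s q (Suc m)"
proof -
  let ?I = "{- int (Suc m)..int (Suc m)}"
  let ?B = "\<lambda>i j. of_bool (gcd i j = int q) :: int"
  define d where "d j = hat (Suc m) j - 2 * hat m j + hat (m - 1) j" for j
  \<comment> \<open>For fixed j, the map n \<mapsto> max 0 (n - \<bar>j\<bar>) is linear apart from
    a kink at n = \<bar>j\<bar>, where the slope jumps from 0 to 1. Its second difference at
    \<open>m\<close> is therefore 1 if \<bar>j\<bar> = m and 0 otherwise; \<open>m \<ge> 1\<close>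
    keeps the two points apart.\<close>
  have d: "d j = of_bool (j = int m) + of_bool (j = - int m)" for j
    using assms(1) by (auto simp: d_def hat_def max_def of_nat_diff)
  have sum_d: "(\<Sum>j \<in> ?I. h j * d j) = h (int m) + h (- int m)" for h :: "int \<Rightarrow> int"
  proof -
    have "(\<Sum>j \<in> ?I. h j * d j) = (\<Sum>j \<in> {int m, - int m}. h j)"
      using assms(1) unfolding d by (intro sum.mono_neutral_cong_right) auto
    then show ?thesis
      using assms(1) by simp
  qed
  have le: "m \<le> Suc m" "m - 1 \<le> Suc m"
    by auto
  have "f q m (Suc m) - 2 * f q m m + f q m (m - 1)
      = (\<Sum>i \<in> ?I. \<Sum>j \<in> ?I. ?B i j * hat m i * d j)"
    unfolding f_eq_sum_hat[OF le(1) order_refl] f_eq_sum_hat[OF le(1) le(1)] f_eq_sum_hat[OF le]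
    by (simp only: sum_distrib_left flip: sum_subtractf sum.distrib) (simp only: d_def algebra_simps)
  \<comment> \<open>The gcd ignores signs, so both lines j = m and j = -m contribute
    equally.\<close>
  also have "\<dots> = (\<Sum>i \<in> ?I. 2 * (?B i (int m) * hat m i))"
    unfolding sum_d by (simp add: mult.commute)
  also have "\<dots> = 2 * (int m * int (e q (m + 1)))"
    unfolding sum_hat_gcd[OF assms le(1), symmetric] sum_distrib_left ..
  also have "\<dots> = s q (Suc m)"
    by (simp add: s_def)
  finally show ?thesis
    using f_commute[of q m "m - 1"] by simp
qed

text \<open>Entries divisible by \<open>q\<close> but smaller than \<open>q\<close> in absolute
  value are 0, and then the gcd is 0 rather than \<open>q\<close>.\<close>

lemma f_eq_0:
  assumes "n1 \<le> q" "n2 \<le> q" "q \<ge> 1"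
  shows "f q n1 n2 = 0"
proof -
  have "gcd i j \<noteq> int q" if "\<bar>i\<bar> < int n1" "\<bar>j\<bar> < int n2" for i j
  proof
    assume g: "gcd i j = int q"
    then have "int q dvd i" "int q dvd j"
      using gcd_dvd1[of i j] gcd_dvd2[of i j] by simp_all
    then have "i = 0" "j = 0"
      using that assms dvd_imp_le_int[of i "int q"] dvd_imp_le_int[of j "int q"] by force+
    with g assms(3) show False
      by simp
  qed
  then have "{(i, j) \<in> {- int n1 <..< int n1} \<times> {- int n2 <..< int n2}. gcd i j = int q} = {}"
    by (auto simp: abs_less_iff)
  then show ?thesis
    unfolding f_def by (simp only: sum.empty)
qed

theorem theorem2:
  fixes q :: nat
  assumes "q \<ge> 1"
  shows "(\<forall>n::nat. n \<ge> 2 \<longrightarrow>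
            f_diag q n = 2 * f q (n - 1) n - f_diag q (n - 1) + r q n \<and>
            f q (n - 1) n = 2 * f_diag q (n - 1) - f q (n - 2) (n - 1) + s q n \<and>
            r q n - r q (n - 1) = 8 * int (e q n)) \<and>
         (\<forall>n::nat. 1 \<le> n \<and> n \<le> q \<longrightarrow> f_diag q n = 0 \<and> f q (n - 1) n = 0)"
proof (intro conjI allI impI; (elim conjE)?)
  fix n :: nat
  assume "n \<ge> 2"
  then obtain m where n: "n = Suc m" and m: "m \<ge> 1"
    by (cases n) auto
  show "f_diag q n = 2 * f q (n - 1) n - f_diag q (n - 1) + r q n"
    using f_diag_Suc[OF assms, of m] by (simp add: n)
  show "f q (n - 1) n = 2 * f_diag q (n - 1) - f q (n - 2) (n - 1) + s q n"
    using f_Suc_right[OF m assms] by (simp add: n numeral_2_eq_2)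
  show "r q n - r q (n - 1) = 8 * int (e q n)"
    using m by (simp add: r_def n)
next
  fix n :: nat
  assume "n \<le> q"
  then show "f_diag q n = 0" "f q (n - 1) n = 0"
    using assms by (simp_all add: f_eq_0)
qed

end
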